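(* Let $W\subset(\mathbb{R}_{\max}^n)^2$ be a closed congruence. Assume that $s,t\in\mathbb{R}_{\max}^n$ are such that $(s,t)\notin W$. Then there exists $y\in\mathbb{R}_{\max}^n$ such that $$(f,g)\in W\implies \oplus_i f_iy_i=\oplus_j g_jy_j$$ and $$\oplus_i s_iy_i\neq\oplus_j t_jy_j.$$
   Context: $\mathbb{R}_{\max}$ is the max-plus semiring: the set $\mathbb{R}\cup\{-\infty\}$ with addition $a\oplus b=\max(a,b)$ and multiplication $ab=a\otimes b=a+b$ (with $-\infty$ absorbing); thus $\oplus_i f_iy_i=\max_i(f_i+y_i)$. $\mathbb{R}_{\max}^n$ is a semimodule with entrywise $\oplus$ and scalar action $(x\lambda)_i=x_i+\lambda$; operations on $(\mathbb{R}_{\max}^n)^2$ are componentwise, and a subsemimodule is a subset stable under all combinations $x\lambda\oplus z\mu$ with $\lambda,\mu\in\mathbb{R}_{\max}$. A congruence is a subsemimodule $W\subset(\mathbb{R}_{\max}^n)^2$ which is an equivalence relation on $\mathbb{R}_{\max}^n$: $(f,f)\in W$ for all $f$; $(f,g)\in W\implies(g,f)\in W$; and $(f,g)\in W,\ (g,h)\in W\implies(f,h)\in W$. "Closed" refers to the product topology, where $\mathbb{R}_{\max}$ carries the metric $d(a,b)=|\exp(a)-\exp(b)|$ (with $\exp(-\infty)=0$). *)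

theory Defs
  imports "HOL-Analysis.Analysis"
begin

datatype rmax = MInf | Fin real

instantiation rmax :: linorder
begin

fun less_eq_rmax :: "rmax \<Rightarrow> rmax \<Rightarrow> bool" where
  "less_eq_rmax MInf b = True"
| "less_eq_rmax (Fin x) MInf = False"
| "less_eq_rmax (Fin x) (Fin y) = (x \<le> y)"

definition less_rmax :: "rmax \<Rightarrow> rmax \<Rightarrow> bool" where
  "less_rmax a b \<longleftrightarrow> a \<le> b \<and> \<not> b \<le> a"

instance
proof
  fix a b c :: rmax
  show "a < b \<longleftrightarrow> a \<le> b \<and> \<not> b \<le> a"
    by (rule less_rmax_def)
  show "a \<le> a"
    by (cases a) auto
  show "a \<le> b \<Longrightarrow> b \<le> c \<Longrightarrow> a \<le> c"
    by (cases a; cases b; cases c) auto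
  show "a \<le> b \<Longrightarrow> b \<le> a \<Longrightarrow> a = b"
    by (cases a; cases b) auto
  show "a \<le> b \<or> b \<le> a"
    by (cases a; cases b) auto
qed

end

text \<open>
  The type-class operations on \<open>rmax\<close> are those of the max-plus semiring:
  \<open>+\<close> is the maximum, with neutral element \<open>0 = MInf\<close>, and \<open>*\<close> is real
  addition, with neutral element \<open>1 = Fin 0\<close>. In particular \<open>sum\<close> over a
  finite set is a maximum, and \<open>*s\<close> adds a scalar to every entry of a vector.
\<close>

instantiation rmax :: comm_semiring_1
begin

definition zero_rmax :: rmax where "0 = MInf"

definition one_rmax :: rmax where "1 = Fin 0"

definition plus_rmax :: "rmax \<Rightarrow> rmax \<Rightarrow> rmax" where
  "a + b = max a (b::rmax)"

fun times_rmax :: "rmax \<Rightarrow> rmax \<Rightarrow> rmax" where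
  "times_rmax MInf b = MInf"
| "times_rmax (Fin x) MInf = MInf"
| "times_rmax (Fin x) (Fin y) = Fin (x + y)"

instance
proof
  fix a b c :: rmax
  show "a * b * c = a * (b * c)"
    by (cases a; cases b; cases c) auto
  show "a * b = b * a"
    by (cases a; cases b) auto
  show "1 * a = a"
    by (cases a) (auto simp: one_rmax_def)
  show "a + b + c = a + (b + c)"
    by (simp add: plus_rmax_def max.assoc)
  show "a + b = b + a"
    by (simp add: plus_rmax_def max.commute)
  show "0 + a = a"
    by (simp add: plus_rmax_def zero_rmax_def)
  show "0 * a = 0" "a * 0 = 0"
    by (cases a; simp add: zero_rmax_def)+
  show "(a + b) * c = a * c + b * c"
    by (cases a; cases b; cases c) (auto simp: plus_rmax_def max_def)
  show "(0::rmax) \<noteq> 1"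
    by (simp add: zero_rmax_def one_rmax_def)
qed

end

primrec rmax_exp :: "rmax \<Rightarrow> real" where
  "rmax_exp MInf = 0"
| "rmax_exp (Fin x) = exp x"

lemma rmax_exp_inject: "rmax_exp a = rmax_exp b \<longleftrightarrow> a = b"
  by (cases a; cases b) simp_all

instantiation rmax :: metric_space
begin

definition dist_rmax :: "rmax \<Rightarrow> rmax \<Rightarrow> real" where
  "dist a b = \<bar>rmax_exp a - rmax_exp b\<bar>"

definition uniformity_rmax :: "(rmax \<times> rmax) filter" where
  "uniformity = (INF e\<in>{0<..}. principal {(a::rmax, b). dist a b < e})"

definition open_rmax :: "rmax set \<Rightarrow> bool" where
  "open (U::rmax set) \<longleftrightarrow> (\<forall>a\<in>U. eventually (\<lambda>(a', b). a' = a \<longrightarrow> b \<in> U) uniformity)"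

instance
proof
  fix a b c :: rmax and U :: "rmax set"
  show "uniformity = (INF e\<in>{0<..}. principal {(a::rmax, b). dist a b < e})"
    by (rule uniformity_rmax_def)
  show "open U \<longleftrightarrow> (\<forall>a\<in>U. eventually (\<lambda>(a', b). a' = a \<longrightarrow> b \<in> U) uniformity)"
    by (rule open_rmax_def)
  show "dist a b = 0 \<longleftrightarrow> a = b"
    by (simp add: dist_rmax_def rmax_exp_inject)
  show "dist a b \<le> dist a c + dist b c"
    by (simp add: dist_rmax_def)
qed

end

definition subsemimodule :: "((rmax ^ 'n) \<times> (rmax ^ 'n)) set \<Rightarrow> bool" where
  "subsemimodule W \<longleftrightarrow>
     (\<forall>x x' z z' l m. (x, x') \<in> W \<longrightarrow> (z, z') \<in> W \<longrightarrow>
        (l *s x + m *s z, l *s x' + m *s z') \<in> W)"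

definition congruence :: "((rmax ^ 'n) \<times> (rmax ^ 'n)) set \<Rightarrow> bool" where
  "congruence W \<longleftrightarrow> subsemimodule W \<and> equiv UNIV W"

end

theory Submission
  imports Defs
begin

text \<open>
  Since the order of the semimodule \<open>rmax ^ 'n\<close> is definable from its addition, \<open>W\<close> induces a
  preorder, \<open>f \<sqsubseteq> g\<close> iff \<open>(f + g, g) \<in> W\<close>, whose associated equivalence is \<open>W\<close>; so we may assume
  that \<open>s \<sqsubseteq> t\<close> fails. Were \<open>t\<close> an order unit, the residuated map
  \<open>f \<mapsto> min {\<lambda>. f \<sqsubseteq> \<lambda> t}\<close>, whose minimum is attained because \<open>W\<close> is closed, would be a
  linear form constant on the classes of \<open>W\<close>, at most \<open>1\<close> at \<open>t\<close> but not at \<open>s\<close>.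
  In general its values may be infinite. Therefore \<open>t\<close> is replaced by \<open>t \<oplus> \<epsilon> (1, \<dots>, 1)\<close>, where
  \<open>\<epsilon> > 0\<close> is so small that \<open>s \<sqsubseteq> t \<oplus> \<epsilon> (1, \<dots>, 1)\<close> still fails; such an \<open>\<epsilon>\<close> exists because \<open>W\<close> is
  closed.
\<close>

section \<open>Continuity of the max-plus operations\<close>

lemma rmax_exp_add: "rmax_exp (a + b) = max (rmax_exp a) (rmax_exp b)"
  by (cases a; cases b) (auto simp: plus_rmax_def max_def)

lemma rmax_exp_mult: "rmax_exp (a * b) = rmax_exp a * rmax_exp b"
  by (cases a; cases b) (auto simp: exp_add)

text \<open>The metric is pulled back along \<open>rmax_exp\<close>, which turns max-plus sums and
  products into maxima and products of reals; continuity is thus inherited from the reals.\<close>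

lemma tendsto_rmax_iff:
  "(f \<longlongrightarrow> a) F \<longleftrightarrow> ((\<lambda>x. rmax_exp (f x)) \<longlongrightarrow> rmax_exp a) F"
  by (simp add: tendsto_iff dist_rmax_def dist_real_def)

lemma tendsto_rmax_add:
  fixes a b :: rmax
  assumes "(f \<longlongrightarrow> a) F" "(g \<longlongrightarrow> b) F"
  shows "((\<lambda>x. f x + g x) \<longlongrightarrow> a + b) F"
  using assms by (simp add: tendsto_rmax_iff rmax_exp_add tendsto_max)

lemma tendsto_rmax_mult:
  fixes a b :: rmax
  assumes "(f \<longlongrightarrow> a) F" "(g \<longlongrightarrow> b) F"
  shows "((\<lambda>x. f x * g x) \<longlongrightarrow> a * b) F"
  using assms by (simp add: tendsto_rmax_iff rmax_exp_mult tendsto_mult)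

lemma tendsto_vec_rmax_add:
  fixes a b :: "rmax ^ 'n"
  assumes "(f \<longlongrightarrow> a) F" "(g \<longlongrightarrow> b) F"
  shows "((\<lambda>x. f x + g x) \<longlongrightarrow> a + b) F"
  using assms by (intro vec_tendstoI) (simp add: tendsto_rmax_add tendsto_vec_nth)

lemma tendsto_vec_rmax_scale:
  fixes v :: "rmax ^ 'n"
  assumes "(c \<longlongrightarrow> l) F"
  shows "((\<lambda>x. c x *s v) \<longlongrightarrow> l *s v) F"
  using assms by (intro vec_tendstoI) (simp add: tendsto_rmax_mult)

lemma tendsto_Fin: "(f \<longlongrightarrow> x) F \<Longrightarrow> ((\<lambda>k. Fin (f k)) \<longlongrightarrow> Fin x) F"
  by (simp add: tendsto_rmax_iff tendsto_exp)

lemma tendsto_Fin_MInf: "(\<lambda>k. Fin (- real k)) \<longlonglongrightarrow> 0"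
proof -
  have "filterlim (\<lambda>k. - real k) at_bot sequentially"
    using filterlim_real_sequentially by (simp add: filterlim_uminus_at_bot)
  then show ?thesis
    by (simp add: tendsto_rmax_iff zero_rmax_def filterlim_compose[OF exp_at_bot])
qed

section \<open>Order of the semiring and least elements\<close>

lemma rmax_le_iff_add: "a \<le> b \<longleftrightarrow> a + b = (b::rmax)"
  by (auto simp: plus_rmax_def max_def)

lemma rmax_zero_le: "0 \<le> (a::rmax)"
  by (simp add: zero_rmax_def)

lemma rmax_sum_le_iff:
  fixes l :: rmax
  assumes "finite A"
  shows "sum f A \<le> l \<longleftrightarrow> (\<forall>i\<in>A. f i \<le> l)"
  using assms by induction (auto simp: plus_rmax_def rmax_zero_le)

lemma Fin_mult_le_iff: "Fin x * a \<le> b \<longleftrightarrow> a \<le> Fin (- x) * b"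
  by (cases a; cases b) auto

lemma vec_rmax_add_idem: "v + v = (v :: rmax ^ 'n)"
  by (simp add: vec_eq_iff plus_rmax_def)

lemma vec_rmax_expansion: "(\<Sum>i\<in>UNIV. f $ i *s axis i 1) = (f :: rmax ^ 'n)"
  by (simp add: vec_eq_iff axis_def if_distrib cong: if_cong)

text \<open>Unless \<open>L\<close> contains the bottom element, its finite part is a nonempty
  closed set of reals that is bounded below, so it contains its infimum.\<close>

lemma closed_upward_rmax_least:
  fixes L :: "rmax set"
  assumes "closed L" "L \<noteq> {}" and up: "\<And>l m. l \<in> L \<Longrightarrow> l \<le> m \<Longrightarrow> m \<in> L"
  shows "\<exists>m. \<forall>l. m \<le> l \<longleftrightarrow> l \<in> L"
proof (cases "0 \<in> L")
  case True
  then show ?thesis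
    using up rmax_zero_le by blast
next
  case False
  define X where "X = {x. Fin x \<in> L}"
  \<comment> \<open>Otherwise \<open>Fin (- k)\<close>, which tends to \<open>0 = MInf\<close>,
    would force \<open>0\<close> into the closed set \<open>L\<close>. As \<open>L\<close> is upward
    closed, \<open>b\<close> bounds \<open>X\<close> below.\<close>
  obtain b where b: "Fin b \<notin> L"
  proof (rule ccontr)
    assume "\<not> thesis"
    then have "\<And>x. Fin x \<in> L"
      using that by blast
    then have "0 \<in> L"
      using closed_sequentially[OF \<open>closed L\<close> _ tendsto_Fin_MInf] by blast
    with False show False ..
  qed
  have "X \<noteq> {}"
    using \<open>L \<noteq> {}\<close> False unfolding X_def zero_rmax_def by (metis Collect_empty_eq equals0I rmax.exhaust)
  moreover have bdd: "bdd_below X"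
  proof (rule bdd_belowI)
    fix x assume "x \<in> X"
    then show "b \<le> x"
      using b up[of "Fin x" "Fin b"] by (force simp: X_def)
  qed
  moreover have "closed X"
    unfolding closed_sequential_limits
  proof (intro allI impI, elim conjE)
    fix u x assume "\<forall>k. u k \<in> X" "u \<longlonglongrightarrow> x"
    then show "x \<in> X"
      using closed_sequentially[OF \<open>closed L\<close> _ tendsto_Fin, of u x] by (simp add: X_def)
  qed
  ultimately have "Inf X \<in> X"
    by (intro closed_contains_Inf)
  have "Fin (Inf X) \<le> l \<longleftrightarrow> l \<in> L" for l
  proof
    show "l \<in> L" if "Fin (Inf X) \<le> l"
      using up[OF _ that] \<open>Inf X \<in> X\<close> by (simp add: X_def)
    show "Fin (Inf X) \<le> l" if "l \<in> L"
      using that False bdd by (cases l) (auto simp: X_def zero_rmax_def intro: cInf_lower)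
  qed
  then show ?thesis
    by blast
qed

section \<open>The preorder induced by a congruence\<close>

definition cong_le :: "((rmax ^ 'n) \<times> (rmax ^ 'n)) set \<Rightarrow> rmax ^ 'n \<Rightarrow> rmax ^ 'n \<Rightarrow> bool" where
  "cong_le W f g \<longleftrightarrow> (f + g, g) \<in> W"

context
  fixes W :: "((rmax ^ 'n) \<times> (rmax ^ 'n)) set"
  assumes W: "congruence W"
begin

lemma congruence_refl: "(f, f) \<in> W"
  using W by (simp add: congruence_def equiv_def refl_on_def)

lemma congruence_sym: "(f, g) \<in> W \<Longrightarrow> (g, f) \<in> W"
  using W unfolding congruence_def equiv_def by (meson symD)

lemma congruence_trans: "(f, g) \<in> W \<Longrightarrow> (g, h) \<in> W \<Longrightarrow> (f, h) \<in> W"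
  using W unfolding congruence_def equiv_def by (meson transD)

lemma congruence_combination:
  "(f, f') \<in> W \<Longrightarrow> (g, g') \<in> W \<Longrightarrow> (l *s f + m *s g, l *s f' + m *s g') \<in> W"
  using W by (simp add: congruence_def subsemimodule_def)

lemma congruence_add: "(f, f') \<in> W \<Longrightarrow> (g, g') \<in> W \<Longrightarrow> (f + g, f' + g') \<in> W"
  using congruence_combination[of f f' g g' 1 1] by simp

lemma congruence_scale: "(f, f') \<in> W \<Longrightarrow> (l *s f, l *s f') \<in> W"
  using congruence_combination[of f f' f f' l 0] by (simp add: vec_eq_iff)

lemma cong_leI: "f + g = g \<Longrightarrow> cong_le W f g"
  by (simp add: cong_le_def congruence_refl)

lemma cong_le_trans:
  assumes "cong_le W f g" "cong_le W g h"
  shows "cong_le W f h"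
proof -
  have fg: "(f + g, g) \<in> W" and gh: "(g + h, h) \<in> W"
    using assms by (simp_all add: cong_le_def)
  \<comment> \<open>The chain is \<open>f + h\<close>, \<open>f + g + h\<close>,
    \<open>g + h\<close>, \<open>h\<close>, with neighbours congruent.\<close>
  have "(f + h, f + (g + h)) \<in> W"
    by (rule congruence_add[OF congruence_refl congruence_sym[OF gh]])
  moreover have "(f + (g + h), g + h) \<in> W"
    using congruence_add[OF fg congruence_refl[of h]] by (simp add: add.assoc)
  ultimately show ?thesis
    unfolding cong_le_def by (rule congruence_trans[OF congruence_trans gh])
qed

lemma cong_le_add:
  assumes "cong_le W f h" "cong_le W g h"
  shows "cong_le W (f + g) h"
proof -
  have "(f + (g + h), f + h) \<in> W"
    using assms(2) by (intro congruence_add congruence_refl) (simp add: cong_le_def)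
  then show ?thesis
    using assms(1) congruence_trans[of "f + (g + h)" "f + h" h] by (simp add: cong_le_def add.assoc)
qed

lemma cong_le_sum: "finite A \<Longrightarrow> (\<And>i. i \<in> A \<Longrightarrow> cong_le W (f i) h) \<Longrightarrow> cong_le W (sum f A) h"
  by (induction A rule: finite_induct) (auto intro: cong_le_add cong_leI)

lemma cong_le_scale: "cong_le W f g \<Longrightarrow> cong_le W (l *s f) (l *s g)"
  unfolding cong_le_def using congruence_scale by (metis vector_add_ldistrib)

text \<open>Finite scalars are invertible. This is the counterpart of \<open>Fin_mult_le_iff\<close>
  for the preorder.\<close>

lemma cong_le_scale_Fin_iff:
  "cong_le W (Fin x *s f) g \<longleftrightarrow> cong_le W f (Fin (- x) *s g)"
proof -
  have inv: "Fin z *s (Fin (- z) *s v) = v" for z and v :: "rmax ^ 'n"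
    by (simp add: one_rmax_def[symmetric])
  show ?thesis
    using cong_le_scale[of "Fin x *s f" g "Fin (- x)"] cong_le_scale[of f "Fin (- x) *s g" "Fin x"]
      inv[of x g] inv[of "- x" f] by auto
qed

lemma congruence_imp_cong_le: "(f, g) \<in> W \<Longrightarrow> cong_le W f g"
  using congruence_add[of f g g g] by (simp add: cong_le_def congruence_refl vec_rmax_add_idem)

lemma cong_le_antisym: "cong_le W f g \<Longrightarrow> cong_le W g f \<Longrightarrow> (f, g) \<in> W"
  unfolding cong_le_def
  using congruence_trans[OF congruence_sym, of "f + g" f g] by (simp add: add.commute)

text \<open>\<open>f\<close> is the sum of its multiples of unit vectors, each of them lies below
  \<open>f\<close>, and sums are least upper bounds for the preorder.\<close>

lemma cong_le_iff_axis:
  "cong_le W f g \<longleftrightarrow> (\<forall>i. cong_le W (f $ i *s axis i 1) g)"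
proof
  assume "cong_le W f g"
  moreover have "cong_le W (f $ i *s axis i 1) f" for i
    by (rule cong_leI) (simp add: vec_eq_iff axis_def plus_rmax_def rmax_zero_le)
  ultimately show "\<forall>i. cong_le W (f $ i *s axis i 1) g"
    using cong_le_trans by blast
next
  assume "\<forall>i. cong_le W (f $ i *s axis i 1) g"
  then show "cong_le W f g"
    using cong_le_sum[of UNIV "\<lambda>i. f $ i *s axis i 1" g] by (simp add: vec_rmax_expansion)
qed

section \<open>Residuation and separation for a closed congruence\<close>

context
  assumes cl: "closed W"
begin

lemma cong_le_lim:
  assumes "\<And>k. cong_le W f (g k)" "g \<longlonglongrightarrow> h"
  shows "cong_le W f h"
  unfolding cong_le_def
proof (rule closed_sequentially[OF cl])
  show "(f + g k, g k) \<in> W" for k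
    using assms(1) by (simp add: cong_le_def)
  show "(\<lambda>k. (f + g k, g k)) \<longlonglongrightarrow> (f + h, h)"
    by (intro tendsto_Pair tendsto_vec_rmax_add tendsto_const assms(2))
qed

text \<open>The admissible scalars form a closed set, because \<open>l *s u\<close> is continuous in
  \<open>l\<close>, and an upward closed one, because \<open>l *s u\<close> is monotone in
  \<open>l\<close>.\<close>

lemma residual_ex:
  assumes "cong_le W f (l *s u)"
  shows "\<exists>m. \<forall>l. m \<le> l \<longleftrightarrow> cong_le W f (l *s u)"
proof -
  let ?L = "{l. cong_le W f (l *s u)}"
  have "closed ?L"
    unfolding closed_sequential_limits
  proof (intro allI impI, elim conjE)
    fix c m assume "\<forall>k. c k \<in> ?L" "c \<longlonglongrightarrow> m"
    then have "cong_le W f (m *s u)"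
      by (intro cong_le_lim[OF _ tendsto_vec_rmax_scale[of c m]]) auto
    then show "m \<in> ?L" ..
  qed
  moreover have "m \<in> ?L" if "l \<in> ?L" "l \<le> m" for l m
  proof -
    have "cong_le W (l *s u) (m *s u)"
      using that(2) by (intro cong_leI) (simp add: rmax_le_iff_add flip: vector_sadd_rdistrib)
    then show ?thesis
      using that(1) cong_le_trans[of f "l *s u"] by simp
  qed
  ultimately have "\<exists>m. \<forall>l. m \<le> l \<longleftrightarrow> l \<in> ?L"
    using assms by (intro closed_upward_rmax_least) auto
  then show ?thesis
    by simp
qed

text \<open>The entries of \<open>y\<close> are the residuals of the unit vectors. A sum is at most
  \<open>l\<close> iff every term is, which matches the decomposition in
  \<open>cong_le_iff_axis\<close>.\<close>

lemma residual_linear_form: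
  assumes unit: "\<And>i. \<exists>l. cong_le W (axis i 1) (l *s u)"
  shows "\<exists>y. \<forall>f l. (\<Sum>i\<in>UNIV. f $ i * y $ i) \<le> l \<longleftrightarrow> cong_le W f (l *s u)"
proof -
  have "\<exists>m. \<forall>l. m \<le> l \<longleftrightarrow> cong_le W (axis i 1) (l *s u)" for i
    using unit[of i] by (elim exE) (rule residual_ex)
  then obtain z where z: "\<And>i l. z i \<le> l \<longleftrightarrow> cong_le W (axis i 1) (l *s u)"
    by metis
  have entry: "a * z i \<le> l \<longleftrightarrow> cong_le W (a *s axis i 1) (l *s u)" for a i l
  proof (cases a)
    case MInf
    then have "a = 0"
      by (simp add: zero_rmax_def)
    then show ?thesis
      by (simp add: rmax_zero_le cong_leI vec_eq_iff)
  next
    case (Fin x)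
    then show ?thesis
      by (simp add: Fin_mult_le_iff z cong_le_scale_Fin_iff)
  qed
  have "(\<Sum>i\<in>UNIV. f $ i * (\<chi> i. z i) $ i) \<le> l \<longleftrightarrow> cong_le W f (l *s u)" for f l
    by (simp add: rmax_sum_le_iff entry cong_le_iff_axis[of f])
  then show ?thesis
    by blast
qed

lemma perturbation_not_cong_le:
  assumes "\<not> cong_le W s t"
  shows "\<exists>x. \<not> cong_le W s (t + Fin x *s 1)"
proof (rule ccontr)
  assume "\<not> ?thesis"
  then have "cong_le W s (t + Fin (- real k) *s 1)" for k
    by simp
  moreover have "(\<lambda>k. t + Fin (- real k) *s 1) \<longlonglongrightarrow> t + 0 *s 1"
    by (intro tendsto_vec_rmax_add tendsto_const tendsto_vec_rmax_scale tendsto_Fin_MInf)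
  ultimately have "cong_le W s (t + 0 *s 1)"
    by (rule cong_le_lim)
  moreover have "t + 0 *s 1 = t"
    by (simp add: vec_eq_iff)
  ultimately show False
    using assms by simp
qed

lemma separation_not_cong_le:
  assumes "\<not> cong_le W s t"
  shows "\<exists>y. (\<forall>f g. (f, g) \<in> W \<longrightarrow> (\<Sum>i\<in>UNIV. f $ i * y $ i) = (\<Sum>j\<in>UNIV. g $ j * y $ j)) \<and>
             (\<Sum>i\<in>UNIV. s $ i * y $ i) \<noteq> (\<Sum>j\<in>UNIV. t $ j * y $ j)"
proof -
  obtain x where x: "\<not> cong_le W s (t + Fin x *s 1)"
    using perturbation_not_cong_le[OF assms] by blast
  define u where "u = t + Fin x *s 1"
  \<comment> \<open>Every entry of this multiple of \<open>u\<close> is at least the unit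
    \<open>Fin 0\<close>, so it dominates every unit vector: \<open>u\<close> is an order
    unit.\<close>
  have "Fin (- x) *s u = Fin (- x) *s t + 1"
    by (simp add: u_def vector_add_ldistrib one_rmax_def[symmetric])
  then have "axis i 1 + Fin (- x) *s u = Fin (- x) *s u" for i
    by (auto simp: vec_eq_iff axis_def plus_rmax_def max_def zero_rmax_def)
  then have "\<exists>l. cong_le W (axis i 1) (l *s u)" for i
    using cong_leI by blast
  then obtain y where y: "\<And>f l. (\<Sum>i\<in>UNIV. f $ i * y $ i) \<le> l \<longleftrightarrow> cong_le W f (l *s u)"
    using residual_linear_form by metis
  \<comment> \<open>Let \<open>l\<close> be the value at \<open>g\<close>. Then \<open>g\<close>,
    and by transitivity \<open>f\<close>, lies below \<open>l *s u\<close>, so the value at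
    \<open>f\<close> is at most \<open>l\<close>.\<close>
  have "(\<Sum>i\<in>UNIV. f $ i * y $ i) \<le> (\<Sum>i\<in>UNIV. g $ i * y $ i)" if "(f, g) \<in> W" for f g
    using congruence_imp_cong_le[OF that] cong_le_trans y by blast
  then have "\<forall>f g. (f, g) \<in> W \<longrightarrow> (\<Sum>i\<in>UNIV. f $ i * y $ i) = (\<Sum>j\<in>UNIV. g $ j * y $ j)"
    using congruence_sym by (blast intro: order_antisym)
  \<comment> \<open>The level \<open>1\<close> separates \<open>s\<close> from \<open>t\<close>:
    since \<open>1 *s u = u\<close>, a value is at most \<open>1\<close> exactly for vectors below
    \<open>u\<close>.\<close>
  moreover have "t + u = u"
    by (simp add: u_def add.assoc[symmetric] vec_rmax_add_idem)
  then have "(\<Sum>i\<in>UNIV. t $ i * y $ i) \<le> 1"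
    by (simp add: y cong_leI)
  moreover have "\<not> (\<Sum>i\<in>UNIV. s $ i * y $ i) \<le> 1"
    using x by (simp add: y u_def)
  ultimately show ?thesis
    by (intro exI[of _ y] conjI) auto
qed

end

end

theorem theorem9:
  fixes W :: "((rmax ^ 'n) \<times> (rmax ^ 'n)) set"
    and s t :: "rmax ^ 'n"
  assumes "congruence W" and "closed W" and "(s, t) \<notin> W"
  shows "\<exists>y :: rmax ^ 'n.
           (\<forall>f g. (f, g) \<in> W \<longrightarrow>
              (\<Sum>i\<in>UNIV. f $ i * y $ i) = (\<Sum>j\<in>UNIV. g $ j * y $ j)) \<and>
           (\<Sum>i\<in>UNIV. s $ i * y $ i) \<noteq> (\<Sum>j\<in>UNIV. t $ j * y $ j)"
proof -
  consider "\<not> cong_le W s t" | "\<not> cong_le W t s"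
    using cong_le_antisym[OF assms(1)] assms(3) by blast
  then show ?thesis
  proof cases
    case 1
    then show ?thesis
      using separation_not_cong_le[OF assms(1,2)] by blast
  next
    case 2
    then show ?thesis
      using separation_not_cong_le[OF assms(1,2), of t s] by metis
  qed
qed

end
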